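(* For an integer $R\ge 1$ let $\alpha\in\mathbb{R}^R$ be given by $\alpha_r=(-1)^{R-r}\frac{r^R}{r!(R-r)!}$, $1\le r\le R$. (a) When $R\ge 3$, $$\min\big\{\alpha^*S\alpha:\ S\in\mathcal{S}^+(R,\mathbb{R}),\ S_{ii}=1\big\}=0,$$ hence the matrix $S_1:=\mathbf{1}\mathbf{1}^*$ is never a solution to this minimization problem. (b) When $R=3$, if $f(X_T)=\mathbb{E}f(X_T)+\mathrm{StD}(f(X_T))\,\varepsilon$ with $\mathbb{P}(\varepsilon=\pm1)=1/2$, then the extrapolation formula stands as an exact quadrature formula.
   Context: $\mathcal{S}^+(R,\mathbb{R})$ is the set of real symmetric nonnegative (positive semidefinite) $R\times R$ matrices; the constraint $S_{ii}=1$ is imposed for all $i\in\{1,\dots,R\}$. $\mathbf{1}\in\mathbb{R}^R$ is the column vector with all entries equal to $1$, so $\mathbf{1}\mathbf{1}^*$ is the $R\times R$ matrix with all entries $1$; $^*$ denotes transposition. $\mathrm{StD}$ denotes standard deviation. $X$ is the strong solution on $[0,T]$ of the SDE $dX_t=b(t,X_t)dt+\sigma(t,X_t)dW_t$, $X_0=x\in\mathbb{R}^d$, and $X^{(1)},\dots,X^{(R)}$ are the solutions of the same SDE driven by standard Brownian motions $W^{(1)},\dots,W^{(R)}$ defined on the same probability space, whose joint covariance structure is left free. The function $f:\mathbb{R}^d\to\mathbb{R}$ is fixed with $\mathrm{Var}(f(X_T))>0$ and belongs to the vector space of functions for which the weak error of the Euler scheme admits an expansion in powers of $1/n$ ($T/n$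 being the step). The multi-step Richardson-Romberg extrapolation estimates $\mathbb{E}f(X_T)$ by averaging copies of $\sum_{r=1}^R\alpha_rf(\bar X^{(r)}_T)$, where $\bar X^{(r)}$ is the Euler scheme of $X^{(r)}$ with step $T/(rn)$; its asymptotic version as $n\to\infty$ is $\sum_{r=1}^R\alpha_rf(X^{(r)}_T)$. When $\mathrm{Var}(f(X_T))$ is normalized to $1$, the variance of the latter is $\alpha^*S^f\alpha$, where $S^f$ is the covariance matrix of $(f(X^{(r)}_T))_{1\le r\le R}$, which is the link with the minimization problem in (a); taking all $W^{(r)}$ equal to $W$ gives $S^f=\mathbf{1}\mathbf{1}^*$. In (b), $\alpha=(\tfrac12,-4,\tfrac92)$, and "exact quadrature formula" means that $\sum_{r=1}^3\alpha_rf(X^{(r)}_T)=\mathbb{E}f(X_T)$ almost surely (zero variance). The situation considered is the one where the minimum in (a) is attained, i.e. $S^f=uu^*$ with $u^*=[1\ -1\ -1]$, which corresponds to $f(X^{(2)}_T)=f(X^{(3)}_T)=2\,\mathbb{E}f(X^{(1)}_T)-f(X^{(1)}_T)$. *)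

theory Defs
  imports "HOL-Probability.Probability" "HOL-Library.Landau_Symbols"
begin

section \<open>The weights and the quadratic minimization problem\<close>

text \<open>
  Vectors and matrices of varying size \<open>R\<close> are functions on the index range \<open>{1..R}\<close>;
  values outside that range are never inspected.
\<close>

definition rr_weight :: "nat \<Rightarrow> nat \<Rightarrow> real" where
  "rr_weight R r = (- 1) ^ (R - r) * real r ^ R / (fact r * fact (R - r))"

definition quad_form :: "nat \<Rightarrow> (nat \<Rightarrow> nat \<Rightarrow> real) \<Rightarrow> (nat \<Rightarrow> real) \<Rightarrow> real" where
  "quad_form R S v = (\<Sum>i=1..R. \<Sum>j=1..R. v i * S i j * v j)"

definition sym_psd :: "nat \<Rightarrow> (nat \<Rightarrow> nat \<Rightarrow> real) \<Rightarrow> bool" where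
  "sym_psd R S \<longleftrightarrow>
     (\<forall>i\<in>{1..R}. \<forall>j\<in>{1..R}. S i j = S j i) \<and> (\<forall>v. 0 \<le> quad_form R S v)"

definition admissible :: "nat \<Rightarrow> (nat \<Rightarrow> nat \<Rightarrow> real) \<Rightarrow> bool" where
  "admissible R S \<longleftrightarrow> sym_psd R S \<and> (\<forall>i\<in>{1..R}. S i i = 1)"

definition outer :: "(nat \<Rightarrow> real) \<Rightarrow> nat \<Rightarrow> nat \<Rightarrow> real" where
  "outer v i j = v i * v j"


section \<open>Brownian motion and its augmented filtration\<close>

definition brownian_motion :: "'a measure \<Rightarrow> real \<Rightarrow> (real \<Rightarrow> 'a \<Rightarrow> real ^ 'q) \<Rightarrow> bool" where
  "brownian_motion M T W \<longleftrightarrow>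
     (\<forall>t\<in>{0..T}. W t \<in> borel_measurable M) \<and>
     (AE \<omega> in M. W 0 \<omega> = 0) \<and>
     (AE \<omega> in M. continuous_on {0..T} (\<lambda>t. W t \<omega>)) \<and>
     (\<forall>(n::nat) (t::nat \<Rightarrow> real). (\<forall>i\<le>n. t i \<in> {0..T}) \<and> (\<forall>i<n. t i \<le> t (Suc i)) \<longrightarrow>
        prob_space.indep_vars M (\<lambda>_. borel) (\<lambda>i \<omega>. W (t (Suc i)) \<omega> - W (t i) \<omega>) {..<n}) \<and>
     (\<forall>s t. 0 \<le> s \<and> s < t \<and> t \<le> T \<longrightarrow>
        prob_space.indep_vars M (\<lambda>_. borel) (\<lambda>j \<omega>. (W t \<omega> - W s \<omega>) $ j) UNIV \<and>
        (\<forall>j. distributed M lborel (\<lambda>\<omega>. (W t \<omega> - W s \<omega>) $ j) (normal_density 0 (sqrt (t - s)))))"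

definition augmented_filtration ::
    "'a measure \<Rightarrow> (real \<Rightarrow> 'a \<Rightarrow> real ^ 'q) \<Rightarrow> real \<Rightarrow> 'a measure" where
  "augmented_filtration M W t =
     sigma (space M)
       ({W s -` B \<inter> space M | s B. s \<in> {0..t} \<and> B \<in> sets borel} \<union> null_sets M)"


section \<open>The It\^o integral\<close>

text \<open>
  The integral up to time \<open>t\<close> of a progressively measurable, almost surely square integrable
  matrix-valued process is the limit in probability of the integrals of bounded adapted step
  processes that approximate the integrand in \<open>L\<^sup>2([0,t])\<close>, in probability.
  A step process is given by a grid \<open>\<tau> 0 \<le> \<dots> \<le> \<tau> n\<close> and its value \<open>\<xi> i\<close>
  on the interval \<open>(\<tau> i, \<tau> (i+1)]\<close>.
\<close>

definition step_integrand ::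
    "'a measure \<Rightarrow> (real \<Rightarrow> 'a \<Rightarrow> real ^ 'q) \<Rightarrow> real \<Rightarrow>
     nat \<Rightarrow> (nat \<Rightarrow> real) \<Rightarrow> (nat \<Rightarrow> 'a \<Rightarrow> real ^ 'q ^ 'd) \<Rightarrow> bool" where
  "step_integrand M W t n \<tau> \<xi> \<longleftrightarrow>
     (\<forall>i\<le>n. \<tau> i \<in> {0..t}) \<and> (\<forall>i<n. \<tau> i \<le> \<tau> (Suc i)) \<and>
     (\<forall>i<n. \<xi> i \<in> borel_measurable (augmented_filtration M W (\<tau> i)) \<and>
            (\<exists>C. \<forall>\<omega>\<in>space M. norm (\<xi> i \<omega>) \<le> C))"

definition step_value ::
    "nat \<Rightarrow> (nat \<Rightarrow> real) \<Rightarrow> (nat \<Rightarrow> 'a \<Rightarrow> real ^ 'q ^ 'd) \<Rightarrow> real \<Rightarrow> 'a \<Rightarrow> real ^ 'q ^ 'd" where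
  "step_value n \<tau> \<xi> s \<omega> = (\<Sum>i<n. indicator {\<tau> i<..\<tau> (Suc i)} s *\<^sub>R \<xi> i \<omega>)"

definition step_integral ::
    "(real \<Rightarrow> 'a \<Rightarrow> real ^ 'q) \<Rightarrow> nat \<Rightarrow> (nat \<Rightarrow> real) \<Rightarrow> (nat \<Rightarrow> 'a \<Rightarrow> real ^ 'q ^ 'd) \<Rightarrow>
     'a \<Rightarrow> real ^ 'd" where
  "step_integral W n \<tau> \<xi> \<omega> = (\<Sum>i<n. \<xi> i \<omega> *v (W (\<tau> (Suc i)) \<omega> - W (\<tau> i) \<omega>))"

definition progressive ::
    "'a measure \<Rightarrow> (real \<Rightarrow> 'a \<Rightarrow> real ^ 'q) \<Rightarrow> real \<Rightarrow> (real \<Rightarrow> 'a \<Rightarrow> real ^ 'q ^ 'd) \<Rightarrow> bool" where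
  "progressive M W t H \<longleftrightarrow>
     (\<forall>u\<in>{0..t}. (\<lambda>(s, \<omega>). H s \<omega>) \<in>
        borel_measurable (restrict_space borel {0..u} \<Otimes>\<^sub>M augmented_filtration M W u))"

definition has_ito_integral ::
    "'a measure \<Rightarrow> (real \<Rightarrow> 'a \<Rightarrow> real ^ 'q) \<Rightarrow> real \<Rightarrow> (real \<Rightarrow> 'a \<Rightarrow> real ^ 'q ^ 'd) \<Rightarrow>
     ('a \<Rightarrow> real ^ 'd) \<Rightarrow> bool" where
  "has_ito_integral M W t H I \<longleftrightarrow>
     progressive M W t H \<and>
     (AE \<omega> in M. (\<integral>\<^sup>+s\<in>{0..t}. ennreal ((norm (H s \<omega>))\<^sup>2) \<partial>lborel) < \<infinity>) \<and>
     I \<in> borel_measurable M \<and>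
     (\<exists>(n :: nat \<Rightarrow> nat) (\<tau> :: nat \<Rightarrow> nat \<Rightarrow> real) (\<xi> :: nat \<Rightarrow> nat \<Rightarrow> 'a \<Rightarrow> real ^ 'q ^ 'd).
        (\<forall>k. step_integrand M W t (n k) (\<tau> k) (\<xi> k)) \<and>
        (\<forall>e>0. (\<lambda>k. measure M {\<omega>\<in>space M.
            (\<integral>\<^sup>+s\<in>{0..t}. ennreal ((norm (step_value (n k) (\<tau> k) (\<xi> k) s \<omega> - H s \<omega>))\<^sup>2) \<partial>lborel)
              > ennreal e}) \<longlonglongrightarrow> 0) \<and>
        (\<forall>e>0. (\<lambda>k. measure M {\<omega>\<in>space M.
            norm (step_integral W (n k) (\<tau> k) (\<xi> k) \<omega> - I \<omega>) > e}) \<longlonglongrightarrow> 0))"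


section \<open>Strong solutions of the stochastic differential equation\<close>

text \<open>
  A strong solution is continuous, adapted to the augmented filtration of the driving
  Brownian motion, and satisfies
  \<open>X\<^sub>t = x + \<integral>\<^sub>0\<^sup>t b(s,X\<^sub>s) ds + \<integral>\<^sub>0\<^sup>t \<sigma>(s,X\<^sub>s) dW\<^sub>s\<close>.
\<close>

definition sde_solution ::
    "'a measure \<Rightarrow> real \<Rightarrow> (real \<Rightarrow> real ^ 'd \<Rightarrow> real ^ 'd) \<Rightarrow> (real \<Rightarrow> real ^ 'd \<Rightarrow> real ^ 'q ^ 'd) \<Rightarrow>
     real ^ 'd \<Rightarrow> (real \<Rightarrow> 'a \<Rightarrow> real ^ 'q) \<Rightarrow> (real \<Rightarrow> 'a \<Rightarrow> real ^ 'd) \<Rightarrow> bool" where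
  "sde_solution M T b \<sigma> x W X \<longleftrightarrow>
     brownian_motion M T W \<and>
     (\<forall>t\<in>{0..T}. X t \<in> borel_measurable (augmented_filtration M W t)) \<and>
     (\<forall>\<omega>\<in>space M. continuous_on {0..T} (\<lambda>t. X t \<omega>)) \<and>
     (AE \<omega> in M. X 0 \<omega> = x) \<and>
     (AE \<omega> in M. set_integrable lborel {0..T} (\<lambda>s. b s (X s \<omega>))) \<and>
     (\<forall>t\<in>{0..T}. has_ito_integral M W t (\<lambda>s \<omega>. \<sigma> s (X s \<omega>))
        (\<lambda>\<omega>. X t \<omega> - x - (LINT s:{0..t}|lborel. b s (X s \<omega>))))"

text \<open>
  The equation has a unique strong solution in the sense of Ikeda and Watanabe: every Brownian
  motion drives a solution, and any solution is almost surely one and the same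
  nonanticipative functional \<open>F\<close> of its driving Brownian path.
\<close>

definition has_unique_strong_solution ::
    "'a measure \<Rightarrow> real \<Rightarrow> (real \<Rightarrow> real ^ 'd \<Rightarrow> real ^ 'd) \<Rightarrow> (real \<Rightarrow> real ^ 'd \<Rightarrow> real ^ 'q ^ 'd) \<Rightarrow>
     real ^ 'd \<Rightarrow> bool" where
  "has_unique_strong_solution M T b \<sigma> x \<longleftrightarrow>
     (\<exists>F :: real \<Rightarrow> (real \<Rightarrow> real ^ 'q) \<Rightarrow> real ^ 'd.
        (\<forall>t\<in>{0..T}. F t \<in> borel_measurable (Pi\<^sub>M {0..t} (\<lambda>_. borel))) \<and>
        (\<forall>W. brownian_motion M T W \<longrightarrow>
           (\<exists>X. sde_solution M T b \<sigma> x W X) \<and>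
           (\<forall>X. sde_solution M T b \<sigma> x W X \<longrightarrow>
              (\<forall>t\<in>{0..T}. AE \<omega> in M. X t \<omega> = F t (restrict (\<lambda>s. W s \<omega>) {0..t})))))"


section \<open>The Euler scheme and the weak error expansion\<close>

text \<open>\<open>euler_scheme T n b \<sigma> x W k\<close> is the value at time \<open>k T / n\<close> of the scheme of step \<open>T / n\<close>.\<close>

fun euler_scheme ::
    "real \<Rightarrow> nat \<Rightarrow> (real \<Rightarrow> real ^ 'd \<Rightarrow> real ^ 'd) \<Rightarrow> (real \<Rightarrow> real ^ 'd \<Rightarrow> real ^ 'q ^ 'd) \<Rightarrow>
     real ^ 'd \<Rightarrow> (real \<Rightarrow> 'a \<Rightarrow> real ^ 'q) \<Rightarrow> nat \<Rightarrow> 'a \<Rightarrow> real ^ 'd" where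
  "euler_scheme T n b \<sigma> x W 0 \<omega> = x"
| "euler_scheme T n b \<sigma> x W (Suc k) \<omega> =
     (let y = euler_scheme T n b \<sigma> x W k \<omega>; s = real k * T / real n; s' = real (Suc k) * T / real n
      in y + (T / real n) *\<^sub>R b s y + \<sigma> s y *v (W s' \<omega> - W s \<omega>))"

text \<open>The expansion up to the order \<open>R\<close> that an \<open>R\<close>-step extrapolation exploits.\<close>

definition weak_error_expansion ::
    "'a measure \<Rightarrow> real \<Rightarrow> (real \<Rightarrow> real ^ 'd \<Rightarrow> real ^ 'd) \<Rightarrow> (real \<Rightarrow> real ^ 'd \<Rightarrow> real ^ 'q ^ 'd) \<Rightarrow>
     real ^ 'd \<Rightarrow> (real \<Rightarrow> 'a \<Rightarrow> real ^ 'q) \<Rightarrow> (real \<Rightarrow> 'a \<Rightarrow> real ^ 'd) \<Rightarrow> nat \<Rightarrow>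
     (real ^ 'd \<Rightarrow> real) \<Rightarrow> bool" where
  "weak_error_expansion M T b \<sigma> x W X R f \<longleftrightarrow>
     (\<forall>n\<ge>1. integrable M (\<lambda>\<omega>. f (euler_scheme T n b \<sigma> x W n \<omega>))) \<and>
     (\<exists>c :: nat \<Rightarrow> real.
        (\<lambda>n. (\<integral>\<omega>. f (euler_scheme T n b \<sigma> x W n \<omega>) \<partial>M) - (\<integral>\<omega>. f (X T \<omega>) \<partial>M)
              - (\<Sum>k=1..<R. c k / real n ^ k))
          \<in> O(\<lambda>n. 1 / real n ^ R))"


section \<open>Covariances of the copies\<close>

definition covariance :: "'a measure \<Rightarrow> ('a \<Rightarrow> real) \<Rightarrow> ('a \<Rightarrow> real) \<Rightarrow> real" where
  "covariance M Y Z = (\<integral>\<omega>. (Y \<omega> - (\<integral>\<omega>'. Y \<omega>' \<partial>M)) * (Z \<omega> - (\<integral>\<omega>'. Z \<omega>' \<partial>M)) \<partial>M)"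

text \<open>Covariance matrix of the family \<open>Y\<close>, normalized by the variance of the reference variable \<open>Y0\<close>.\<close>

definition normalized_cov ::
    "'a measure \<Rightarrow> ('a \<Rightarrow> real) \<Rightarrow> (nat \<Rightarrow> 'a \<Rightarrow> real) \<Rightarrow> nat \<Rightarrow> nat \<Rightarrow> real" where
  "normalized_cov M Y0 Y r s = covariance M (Y r) (Y s) / prob_space.variance M Y0"

end

theory Submission
  imports Defs "HOL-Computational_Algebra.Formal_Power_Series"
begin

text \<open>
  The weights \<open>\<alpha>\<^sub>1, \<dots>, \<alpha>\<^sub>R\<close> alternate in sign and sum to \<open>1\<close> (\<open>sum_rr_weight\<close>). A correlation matrix
  is the Gram matrix of unit vectors \<open>z\<^sub>1, \<dots>, z\<^sub>R\<close>, and its value on \<open>\<alpha>\<close> is the squared length of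
  \<open>\<Sum> \<alpha>\<^sub>r z\<^sub>r\<close>. The minimum is therefore \<open>0\<close> as soon as segments of lengths \<open>\<bar>\<alpha>\<^sub>r\<bar>\<close> can be bent
  into a closed polygon, that is, as soon as no length exceeds the sum of the others. The positive and negative
  parts differ by only \<open>1\<close>, so this holds when the positive part splits into two groups of total at least
  \<open>1/2\<close> each; for \<open>R \<ge> 3\<close> the indices \<open>R\<close> and \<open>R - 2\<close> provide such groups
  (\<open>rr_weights_close_polygon\<close>). The all-ones matrix corresponds to equal vectors and gives
  \<open>(\<Sum> \<alpha>\<^sub>r)\<^sup>2 = 1\<close>.

  For the exact quadrature formula, the prescribed covariance matrix makes the variance of
  \<open>\<Sum> \<alpha>\<^sub>r f(X\<^sup>r\<^sub>T)\<close> vanish, so this variable equals its mean almost surely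
  (\<open>zero_variance_combination\<close>). Covariances say nothing about means; that all copies have the mean
  of \<open>f(X\<^sub>T)\<close> is uniqueness in law for the stochastic differential equation. Here it needs no stochastic calculus:
  strong uniqueness writes every solution as one measurable functional of its driving path
  (\<open>strong_solution_law_eq\<close>), and two Brownian motions have the same path law because their
  finite-dimensional marginals are determined by independent Gaussian increments (\<open>brownian_path_law_eq\<close>).
\<close>

section \<open>The minimization problem\<close>

text \<open>
  Up to the factor \<open>R!\<close> the sum is the \<open>R\<close>-th finite difference of \<open>r\<^sup>R\<close> at \<open>0\<close>. The binomial theorem
  identifies it with the coefficient of \<open>X\<^sup>R\<close> in \<open>(e\<^sup>X - 1)\<^sup>R = (X + \<dots>)\<^sup>R\<close>, which is \<open>1\<close>.
\<close>

lemma sum_rr_weight: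
  assumes "0 < R"
  shows "(\<Sum>r=1..R. rr_weight R r) = 1"
proof -
  have "1 = fps_nth ((fps_exp 1 - 1) ^ R :: real fps) R"
    by (subst startsby_zero_power_nth_same) auto
  also have "((fps_exp 1 - 1) ^ R :: real fps)
      = (\<Sum>r\<le>R. fps_const (of_nat (R choose r) * (- 1) ^ (R - r)) * fps_exp (of_nat r))"
    using binomial_ring[of "fps_exp 1 :: real fps" "- 1" R]
    by (simp add: fps_exp_power_mult fps_of_nat mult_ac
        flip: fps_const_mult fps_const_power fps_const_neg)
  also have "fps_nth \<dots> R = (\<Sum>r\<le>R. of_nat (R choose r) * (- 1) ^ (R - r) * (real r ^ R / fact R))"
    by (simp add: fps_sum_nth)
  also have "\<dots> = (\<Sum>r\<le>R. rr_weight R r)"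
    by (intro sum.cong) (simp_all add: rr_weight_def binomial_fact field_simps)
  \<comment> \<open>The term \<open>r = 0\<close> vanishes because \<open>0\<^sup>R = 0\<close> for \<open>R > 0\<close>.\<close>
  also have "\<dots> = (\<Sum>r=1..R. rr_weight R r)"
    using assms by (intro sum.mono_neutral_right) (auto simp: rr_weight_def not_le Suc_le_eq)
  finally show ?thesis by simp
qed

text \<open>
  A triangle with sides \<open>a\<close>, \<open>b\<close>, \<open>c\<close> is placed in the complex plane with the side \<open>c\<close> along the positive real
  axis; \<open>p\<close> and \<open>q\<close> are the directions of the other two sides.
\<close>

lemma triangle_unit_vectors:
  fixes a b c :: real
  assumes "0 < a" "0 < b" "0 < c" and tri: "a \<le> b + c" "b \<le> a + c" "c \<le> a + b"
  obtains p q :: complex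
  where "norm p = 1" "norm q = 1" "of_real a * p + of_real b * q = of_real c"
proof -
  \<comment> \<open>Law of cosines: the cosine of the angle between the sides \<open>a\<close> and \<open>c\<close>.\<close>
  define x where "x = (a\<^sup>2 + c\<^sup>2 - b\<^sup>2) / (2 * a * c)"
  define p where "p = Complex x (sqrt (1 - x\<^sup>2))"
  define q where "q = (of_real c - of_real a * p) / of_real b"
  have "(a - c)\<^sup>2 \<le> b\<^sup>2" "b\<^sup>2 \<le> (a + c)\<^sup>2"
    using assms by (auto intro: power_mono simp: abs_le_square_iff[symmetric])
  hence "\<bar>x\<bar> \<le> 1"
    using assms by (auto simp: x_def abs_le_iff field_simps power2_eq_square)
  hence sq: "(sqrt (1 - x\<^sup>2))\<^sup>2 = 1 - x\<^sup>2"
    by (simp add: abs_square_le_1)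
  have "norm p = 1"
    by (simp add: p_def cmod_def sq)
  have "(norm (of_real c - of_real a * p))\<^sup>2 = (c - a * x)\<^sup>2 + (a * sqrt (1 - x\<^sup>2))\<^sup>2"
    by (simp add: p_def cmod_power2)
  also have "\<dots> = c\<^sup>2 - 2 * a * c * x + a\<^sup>2"
    by (simp add: power_mult_distrib sq) (simp add: power2_eq_square algebra_simps)
  also have "\<dots> = b\<^sup>2"
    using assms by (simp add: x_def)
  finally have "norm (of_real c - of_real a * p) = b"
    using assms by (simp add: power2_eq_iff_nonneg)
  hence "norm q = 1"
    using assms by (simp add: q_def norm_divide)
  moreover have "of_real a * p + of_real b * q = of_real c"
    using assms by (simp add: q_def)
  ultimately show thesis
    using that \<open>norm p = 1\<close> by blast
qed

text \<open>
  Unit vectors of the plane already realize the minimum, so Gram matrices of complex numbers, with the real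
  inner product of \<open>\<complex> = \<real>\<^sup>2\<close>, suffice.
\<close>

definition gram :: "(nat \<Rightarrow> complex) \<Rightarrow> nat \<Rightarrow> nat \<Rightarrow> real" where
  "gram z i j = Re (z i * cnj (z j))"

lemma quad_form_gram:
  "quad_form R (gram z) v = (norm (\<Sum>i=1..R. of_real (v i) * z i))\<^sup>2"
proof -
  have "of_real ((norm (\<Sum>i=1..R. of_real (v i) * z i))\<^sup>2)
      = (\<Sum>i=1..R. of_real (v i) * z i) * cnj (\<Sum>i=1..R. of_real (v i) * z i)"
    by (rule complex_norm_square)
  also have "\<dots> = (\<Sum>i=1..R. \<Sum>j=1..R. of_real (v i * v j) * (z i * cnj (z j)))"
    by (simp add: sum_product mult_ac)
  finally have "(norm (\<Sum>i=1..R. of_real (v i) * z i))\<^sup>2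
      = Re (\<Sum>i=1..R. \<Sum>j=1..R. of_real (v i * v j) * (z i * cnj (z j)))"
    by (metis Re_complex_of_real)
  thus ?thesis
    by (simp add: quad_form_def gram_def algebra_simps)
qed

lemma admissible_gram:
  assumes "\<And>i. i \<in> {1..R} \<Longrightarrow> norm (z i) = 1"
  shows "admissible R (gram z)"
proof -
  have "gram z i j = gram z j i" for i j
    by (simp add: gram_def mult.commute)
  moreover have "gram z i i = (norm (z i))\<^sup>2" for i
    unfolding cmod_power2 by (simp add: gram_def power2_eq_square)
  ultimately show ?thesis
    using assms by (auto simp: admissible_def sym_psd_def quad_form_gram)
qed

text \<open>
  The absolute values of the weights satisfy the polygon inequality, so segments of these lengths close up in the
  plane. It is enough to use three directions: one for the weight of index \<open>R\<close>, one for the other positive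
  weights and one for the negative weights. With the group totals \<open>a\<close>, \<open>b\<close> and \<open>- c\<close>, the identity
  \<open>a + b - c = 1\<close> reduces the triangle inequalities to \<open>1/2 \<le> a\<close> and \<open>1/2 \<le> b\<close>. The latter is
  where \<open>R \<ge> 3\<close> enters: the weight of index \<open>R - 2\<close> exists and is at least \<open>1/2\<close>.
\<close>

lemma rr_weights_close_polygon:
  assumes "3 \<le> R"
  obtains z :: "nat \<Rightarrow> complex"
  where "\<And>r. norm (z r) = 1" "(\<Sum>r=1..R. of_real (rr_weight R r) * z r) = 0"
proof -
  define P where "P = {r\<in>{1..<R}. even (R - r)}"
  define N where "N = {r\<in>{1..<R}. odd (R - r)}"
  define a where "a = rr_weight R R"
  define b where "b = (\<Sum>r\<in>P. rr_weight R r)"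
  define c where "c = - (\<Sum>r\<in>N. rr_weight R r)"
  have three_groups: "(\<Sum>r=1..R. g r) = g R + (\<Sum>r\<in>P. g r) + (\<Sum>r\<in>N. g r)"
    for g :: "nat \<Rightarrow> 'b::comm_monoid_add"
  proof -
    have "{1..R} = insert R (P \<union> N)"
      using assms by (auto simp: P_def N_def)
    moreover have "R \<notin> P \<union> N" "P \<inter> N = {}" "finite P" "finite N"
      by (auto simp: P_def N_def)
    ultimately show ?thesis
      by (simp add: sum.union_disjoint add.assoc)
  qed
  have "a + b - c = 1"
    using three_groups[of "rr_weight R"] sum_rr_weight[of R] assms by (simp add: a_def b_def c_def)
  have fact_le: "fact n \<le> real n ^ n" for n
    using fact_le_power[of n, where 'a = real] by simp
  have "1 \<le> a"
    using fact_le[of R] by (simp add: a_def rr_weight_def)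
  have "1 / 2 \<le> rr_weight R (R - 2)"
  proof -
    have "fact (R - 2) \<le> real (R - 2) ^ (R - 2)"
      by (rule fact_le)
    also have "\<dots> \<le> real (R - 2) ^ R"
      using assms by (intro power_increasing) auto
    finally show ?thesis
      using assms by (simp add: rr_weight_def numeral_2_eq_2 field_simps)
  qed
  also have "\<dots> \<le> b"
    unfolding b_def
  proof (rule member_le_sum)
    show "R - 2 \<in> P"
      using assms by (auto simp: P_def)
  qed (auto simp: P_def rr_weight_def)
  finally have "1 / 2 \<le> b" .
  obtain p q :: complex where pq: "norm p = 1" "norm q = 1"
      "of_real a * p + of_real b * q = of_real c"
    by (rule triangle_unit_vectors[of a b c])
      (use \<open>1 \<le> a\<close> \<open>1 / 2 \<le> b\<close> \<open>a + b - c = 1\<close> in auto)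
  define z where "z r = (if r = R then p else if even (R - r) then q else 1)" for r
  have "(\<Sum>r=1..R. of_real (rr_weight R r) * z r)
      = of_real a * p + (\<Sum>r\<in>P. of_real (rr_weight R r) * q) + (\<Sum>r\<in>N. of_real (rr_weight R r))"
    unfolding three_groups by (intro arg_cong2[where f = "(+)"] sum.cong)
      (auto simp: z_def a_def P_def N_def)
  also have "\<dots> = of_real a * p + of_real b * q - of_real c"
    by (simp add: b_def c_def sum_distrib_right)
  finally have "(\<Sum>r=1..R. of_real (rr_weight R r) * z r) = 0"
    by (simp add: pq)
  moreover have "norm (z r) = 1" for r
    by (simp add: z_def pq)
  ultimately show thesis
    using that by blast
qed

text \<open>
  A Gram matrix of vectors closing the weighted polygon annihilates the quadratic form, whereas the all-ones matrix
  gives the square of the sum of the weights, which is \<open>1\<close>.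
\<close>

lemma rr_weight_minimum_zero:
  assumes "3 \<le> R"
  shows "\<exists>S. is_arg_min (\<lambda>S. quad_form R S (rr_weight R)) (admissible R) S \<and>
             quad_form R S (rr_weight R) = 0"
    and "\<not> is_arg_min (\<lambda>S. quad_form R S (rr_weight R)) (admissible R) (outer (\<lambda>_. 1))"
proof -
  obtain z :: "nat \<Rightarrow> complex" where z: "\<And>r. norm (z r) = 1"
      "(\<Sum>r=1..R. of_real (rr_weight R r) * z r) = 0"
    using rr_weights_close_polygon[OF assms] by blast
  have adm: "admissible R (gram z)"
    by (rule admissible_gram) (simp add: z)
  have zero: "quad_form R (gram z) (rr_weight R) = 0"
    by (simp only: quad_form_gram z) simp
  show "\<exists>S. is_arg_min (\<lambda>S. quad_form R S (rr_weight R)) (admissible R) S \<and>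
             quad_form R S (rr_weight R) = 0"
    using adm zero by (intro exI[of _ "gram z"])
      (auto simp: is_arg_min_def admissible_def sym_psd_def not_less)
  have "outer (\<lambda>_. 1) = gram (\<lambda>_. 1)"
    by (simp add: outer_def gram_def fun_eq_iff)
  hence "quad_form R (outer (\<lambda>_. 1)) (rr_weight R) = 1"
    using sum_rr_weight[of R] assms by (simp add: quad_form_gram flip: of_real_sum)
  thus "\<not> is_arg_min (\<lambda>S. quad_form R S (rr_weight R)) (admissible R) (outer (\<lambda>_. 1))"
    using adm zero by (auto simp: is_arg_min_def intro!: exI[of _ "gram z"])
qed

section \<open>The law of a Brownian path\<close>

lemma indep_vars_joint_law_eq:
  assumes "prob_space M" "prob_space N" "I \<noteq> {}"
    and X: "prob_space.indep_vars M S X I" and Y: "prob_space.indep_vars N S Y I"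
    and marginal: "\<And>i. i \<in> I \<Longrightarrow> distr M (S i) (X i) = distr N (S i) (Y i)"
  shows "distr M (Pi\<^sub>M I S) (\<lambda>\<omega>. \<lambda>i\<in>I. X i \<omega>) = distr N (Pi\<^sub>M I S) (\<lambda>\<omega>. \<lambda>i\<in>I. Y i \<omega>)"
proof -
  interpret M: prob_space M by fact
  interpret N: prob_space N by fact
  have "distr M (Pi\<^sub>M I S) (\<lambda>\<omega>. \<lambda>i\<in>I. X i \<omega>) = (\<Pi>\<^sub>M i\<in>I. distr M (S i) (X i))"
    using X \<open>I \<noteq> {}\<close> M.indep_vars_iff_distr_eq_PiM'[where I = I and X = X and M' = S]
    by (auto simp: M.indep_vars_def)
  also have "\<dots> = (\<Pi>\<^sub>M i\<in>I. distr N (S i) (Y i))"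
    by (intro PiM_cong refl marginal)
  also have "\<dots> = distr N (Pi\<^sub>M I S) (\<lambda>\<omega>. \<lambda>i\<in>I. Y i \<omega>)"
    using Y \<open>I \<noteq> {}\<close> N.indep_vars_iff_distr_eq_PiM'[where I = I and X = Y and M' = S]
    by (auto simp: N.indep_vars_def)
  finally show ?thesis .
qed

lemma vec_lambda_measurable:
  "(\<lambda>g. (\<chi> i. g i) :: real ^ 'q) \<in> borel_measurable (Pi\<^sub>M UNIV (\<lambda>_. borel))"
proof (subst borel_measurable_euclidean_space, rule ballI)
  fix v :: "real ^ 'q" assume "v \<in> Basis"
  then obtain i where "v = axis i 1"
    by (auto simp: Basis_vec_def)
  moreover have "(\<lambda>g. g i) \<in> borel_measurable (Pi\<^sub>M UNIV (\<lambda>_::'q. borel :: real measure))"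
    by (rule measurable_component_singleton) simp
  ultimately show "(\<lambda>g. (\<chi> i. g i) \<bullet> v) \<in> borel_measurable (Pi\<^sub>M UNIV (\<lambda>_. borel))"
    by (simp add: inner_axis)
qed

lemma indep_components_law_eq:
  fixes X :: "'a \<Rightarrow> real ^ 'q" and Y :: "'b \<Rightarrow> real ^ 'q"
  assumes "prob_space M" "prob_space N"
    and X: "prob_space.indep_vars M (\<lambda>_. borel) (\<lambda>i \<omega>. X \<omega> $ i) UNIV"
    and Y: "prob_space.indep_vars N (\<lambda>_. borel) (\<lambda>i \<omega>. Y \<omega> $ i) UNIV"
    and marginal: "\<And>i. distr M borel (\<lambda>\<omega>. X \<omega> $ i) = distr N borel (\<lambda>\<omega>. Y \<omega> $ i)"
  shows "distr M borel X = distr N borel Y"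
proof -
  interpret M: prob_space M by fact
  interpret N: prob_space N by fact
  have recover: "distr L borel Z = distr (distr L (Pi\<^sub>M UNIV (\<lambda>_. borel)) (\<lambda>\<omega>. \<lambda>i\<in>UNIV. Z \<omega> $ i))
      borel (\<lambda>g. \<chi> i. g i)"
    if "\<And>i. (\<lambda>\<omega>. Z \<omega> $ i) \<in> borel_measurable L" for L :: "'c measure" and Z :: "'c \<Rightarrow> real ^ 'q"
  proof -
    have "(\<lambda>\<omega>. \<lambda>i\<in>UNIV. Z \<omega> $ i) \<in> L \<rightarrow>\<^sub>M Pi\<^sub>M UNIV (\<lambda>_. borel)"
      by (intro measurable_restrict that)
    thus ?thesis
      by (simp add: distr_distr[OF vec_lambda_measurable] comp_def restrict_UNIV)
  qed
  have rv: "(\<lambda>\<omega>. X \<omega> $ i) \<in> borel_measurable M" "(\<lambda>\<omega>. Y \<omega> $ i) \<in> borel_measurable N" for i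
    using X Y unfolding M.indep_vars_def N.indep_vars_def by simp_all
  have "distr M (Pi\<^sub>M UNIV (\<lambda>_. borel)) (\<lambda>\<omega>. \<lambda>i\<in>UNIV. X \<omega> $ i)
      = distr N (Pi\<^sub>M UNIV (\<lambda>_. borel)) (\<lambda>\<omega>. \<lambda>i\<in>UNIV. Y \<omega> $ i)"
    by (rule indep_vars_joint_law_eq[OF assms(1,2) _ X Y marginal]) simp
  thus ?thesis
    by (simp only: recover[of X M, OF rv(1)] recover[of Y N, OF rv(2)])
qed

text \<open>
  The case \<open>s = t\<close> is separate: repeated grid points are permitted in the independence property, but a null
  increment has no density.
\<close>

lemma brownian_increment_law_eq:
  assumes "prob_space M" "prob_space N"
    and W: "brownian_motion M T W" and V: "brownian_motion N T V"
    and "0 \<le> s" "s \<le> t" "t \<le> T"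
  shows "distr M borel (\<lambda>\<omega>. W t \<omega> - W s \<omega>) = distr N borel (\<lambda>\<omega>. V t \<omega> - V s \<omega>)"
proof (cases "s = t")
  case True
  interpret M: prob_space M by fact
  interpret N: prob_space N by fact
  show ?thesis
    using True by simp
next
  case False
  with assms have st: "0 \<le> s \<and> s < t \<and> t \<le> T" by simp
  have indep: "prob_space.indep_vars L (\<lambda>_. borel) (\<lambda>i \<omega>. (B t \<omega> - B s \<omega>) $ i) UNIV"
    and gauss: "distr L borel (\<lambda>\<omega>. (B t \<omega> - B s \<omega>) $ i)
      = density lborel (normal_density 0 (sqrt (t - s)))"
    if B: "brownian_motion L T B" for L :: "'d measure" and B :: "real \<Rightarrow> 'd \<Rightarrow> real ^ 'c" and i
  proof -
    show "prob_space.indep_vars L (\<lambda>_. borel) (\<lambda>i \<omega>. (B t \<omega> - B s \<omega>) $ i) UNIV"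
      using B st unfolding brownian_motion_def by blast
    have "distributed L lborel (\<lambda>\<omega>. (B t \<omega> - B s \<omega>) $ i) (normal_density 0 (sqrt (t - s)))"
      using B st unfolding brownian_motion_def by blast
    moreover have "distr L borel Z = distr L lborel Z" for Z :: "'d \<Rightarrow> real"
      by (intro distr_cong) simp_all
    ultimately show "distr L borel (\<lambda>\<omega>. (B t \<omega> - B s \<omega>) $ i)
        = density lborel (normal_density 0 (sqrt (t - s)))"
      by (simp only: distributed_def)
  qed
  show ?thesis
    by (rule indep_components_law_eq[OF assms(1,2) indep[OF W] indep[OF V]])
      (simp only: gauss[OF W] gauss[OF V])
qed

text \<open>
  The grid starts at \<open>0\<close>, the time at which the Brownian value is known; it may repeat \<open>0\<close>, which
  guarantees at least one increment even if \<open>J\<close> is empty.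
\<close>

lemma increasing_grid_through_finite_set:
  fixes J :: "real set"
  assumes "finite J" "J \<subseteq> {0..T}" "0 \<le> T"
  obtains n :: nat and t :: "nat \<Rightarrow> real" and k :: "real \<Rightarrow> nat"
  where "0 < n" "t 0 = 0" "\<And>i. i \<le> n \<Longrightarrow> t i \<in> {0..T}" "\<And>i. i < n \<Longrightarrow> t i \<le> t (Suc i)"
    "\<And>s. s \<in> J \<Longrightarrow> k s \<le> n \<and> t (k s) = s"
proof -
  \<comment> \<open>The list contains \<open>0\<close> in every case, so the grid \<open>0, l!0, l!1, \<dots>\<close> has positive length.\<close>
  define l where "l = sorted_list_of_set (insert 0 J)"
  have l: "set l = insert 0 J" "sorted l"
    using assms by (simp_all add: l_def del: sorted_list_of_set_insert_remove)
  define t where "t i = (if i = 0 then 0 else l ! (i - 1))" for i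
  have in_l: "t i \<in> insert 0 J" if "i \<le> length l" for i
    using that nth_mem[of "i - 1" l] l(1) by (cases "i = 0") (auto simp: t_def)
  have "\<forall>s\<in>J. \<exists>k. k \<le> length l \<and> t k = s"
  proof
    fix s assume "s \<in> J"
    then obtain i where "i < length l" "l ! i = s"
      using l(1) by (metis in_set_conv_nth insertI2)
    thus "\<exists>k. k \<le> length l \<and> t k = s"
      by (intro exI[of _ "Suc i"]) (simp add: t_def)
  qed
  then obtain k where k: "\<And>s. s \<in> J \<Longrightarrow> k s \<le> length l \<and> t (k s) = s"
    by metis
  show thesis
  proof (rule that[of "length l" t k])
    show "0 < length l"
      using l(1) by auto
    show t_in: "t i \<in> {0..T}" if "i \<le> length l" for i
      using in_l[OF that] assms by auto
    show "t i \<le> t (Suc i)" if "i < length l" for i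
      using t_in[of "Suc i"] that l(2)
      by (cases i) (auto simp: t_def sorted_iff_nth_Suc)
  qed (use k in \<open>auto simp: t_def\<close>)
qed

text \<open>
  The values at the times in \<open>J\<close> are partial sums of the independent increments along a grid through \<open>J\<close>, hence
  the image of the increment vector under a measurable map that does not depend on the process.
\<close>

lemma brownian_finite_marginal_law_eq:
  assumes "prob_space M" "prob_space N" "0 \<le> T"
    and W: "brownian_motion M T W" and V: "brownian_motion N T V"
    and J: "finite J" "J \<subseteq> {0..T}"
  shows "distr M (Pi\<^sub>M J (\<lambda>_. borel)) (\<lambda>\<omega>. \<lambda>s\<in>J. W s \<omega>)
       = distr N (Pi\<^sub>M J (\<lambda>_. borel)) (\<lambda>\<omega>. \<lambda>s\<in>J. V s \<omega>)"
proof -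
  obtain n t k where grid: "0 < n" "t 0 = 0" "\<And>i. i \<le> n \<Longrightarrow> t i \<in> {0..T}"
      "\<And>i. i < n \<Longrightarrow> t i \<le> t (Suc i)" "\<And>s. s \<in> J \<Longrightarrow> k s \<le> n \<and> t (k s) = s"
    using increasing_grid_through_finite_set[OF J \<open>0 \<le> T\<close>] by blast
  define G :: "(nat \<Rightarrow> real ^ 'c) \<Rightarrow> real \<Rightarrow> real ^ 'c"
    where "G d = (\<lambda>s\<in>J. \<Sum>i<k s. d i)" for d
  have G: "G \<in> Pi\<^sub>M {..<n} (\<lambda>_. borel) \<rightarrow>\<^sub>M Pi\<^sub>M J (\<lambda>_. borel)"
    unfolding G_def using grid(5)
    by (intro measurable_restrict borel_measurable_sum measurable_component_singleton) force
  have recover: "distr L (Pi\<^sub>M J (\<lambda>_. borel)) (\<lambda>\<omega>. \<lambda>s\<in>J. B s \<omega>)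
      = distr (distr L (Pi\<^sub>M {..<n} (\<lambda>_. borel)) (\<lambda>\<omega>. \<lambda>i\<in>{..<n}. B (t (Suc i)) \<omega> - B (t i) \<omega>))
          (Pi\<^sub>M J (\<lambda>_. borel)) G"
    if B: "brownian_motion L T B" for L :: "'d measure" and B :: "real \<Rightarrow> 'd \<Rightarrow> real ^ 'c"
  proof -
    have rv: "B s \<in> borel_measurable L" if "s \<in> {0..T}" for s
      using B that by (auto simp: brownian_motion_def)
    have D: "(\<lambda>\<omega>. \<lambda>i\<in>{..<n}. B (t (Suc i)) \<omega> - B (t i) \<omega>) \<in> L \<rightarrow>\<^sub>M Pi\<^sub>M {..<n} (\<lambda>_. borel)"
      by (intro measurable_restrict borel_measurable_diff rv grid(3)) auto
    have "AE \<omega> in L. B 0 \<omega> = 0"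
      using B by (simp add: brownian_motion_def)
    hence "AE \<omega> in L. (\<lambda>s\<in>J. B s \<omega>) = G (\<lambda>i\<in>{..<n}. B (t (Suc i)) \<omega> - B (t i) \<omega>)"
    proof eventually_elim
      case (elim \<omega>)
      have "(\<Sum>i<k s. (\<lambda>i\<in>{..<n}. B (t (Suc i)) \<omega> - B (t i) \<omega>) i) = B s \<omega>" if "s \<in> J" for s
      proof -
        have "(\<Sum>i<k s. (\<lambda>i\<in>{..<n}. B (t (Suc i)) \<omega> - B (t i) \<omega>) i)
            = (\<Sum>i<k s. B (t (Suc i)) \<omega> - B (t i) \<omega>)"
          using grid(5)[OF that] by (intro sum.cong) auto
        also have "\<dots> = B s \<omega>"
          using grid(5)[OF that] grid(2) elim by (simp add: sum_lessThan_telescope[of "\<lambda>i. B (t i) \<omega>"])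
        finally show ?thesis .
      qed
      thus ?case
        by (simp add: G_def fun_eq_iff restrict_def)
    qed
    hence "distr L (Pi\<^sub>M J (\<lambda>_. borel)) (\<lambda>\<omega>. \<lambda>s\<in>J. B s \<omega>)
        = distr L (Pi\<^sub>M J (\<lambda>_. borel)) (\<lambda>\<omega>. G (\<lambda>i\<in>{..<n}. B (t (Suc i)) \<omega> - B (t i) \<omega>))"
      using J(2) by (intro distr_cong_AE refl measurable_restrict rv measurable_compose[OF D G]) auto
    thus ?thesis
      by (simp add: distr_distr[OF G D] comp_def)
  qed
  have indep: "prob_space.indep_vars L (\<lambda>_. borel) (\<lambda>i \<omega>. B (t (Suc i)) \<omega> - B (t i) \<omega>) {..<n}"
    if "brownian_motion L T B" for L :: "'d measure" and B :: "real \<Rightarrow> 'd \<Rightarrow> real ^ 'c"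
    using that grid(3,4) unfolding brownian_motion_def by blast
  have "distr M (Pi\<^sub>M {..<n} (\<lambda>_. borel)) (\<lambda>\<omega>. \<lambda>i\<in>{..<n}. W (t (Suc i)) \<omega> - W (t i) \<omega>)
      = distr N (Pi\<^sub>M {..<n} (\<lambda>_. borel)) (\<lambda>\<omega>. \<lambda>i\<in>{..<n}. V (t (Suc i)) \<omega> - V (t i) \<omega>)"
  proof (rule indep_vars_joint_law_eq[OF assms(1,2)])
    show "distr M borel (\<lambda>\<omega>. W (t (Suc i)) \<omega> - W (t i) \<omega>)
        = distr N borel (\<lambda>\<omega>. V (t (Suc i)) \<omega> - V (t i) \<omega>)" if "i \<in> {..<n}" for i
      using that grid(3)[of i] grid(3)[of "Suc i"] grid(4)[of i]
      by (intro brownian_increment_law_eq[OF assms(1,2) W V]) auto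
  qed (use grid(1) indep W V in auto)
  thus ?thesis
    by (simp add: recover[OF W] recover[OF V])
qed

text \<open>
  Cylinder sets form an intersection-stable generator of the product \<open>\<sigma>\<close>-algebra, and each of them depends on
  finitely many times only.
\<close>

lemma brownian_path_law_eq:
  assumes "prob_space M" "prob_space N" "0 \<le> T"
    and W: "brownian_motion M T W" and V: "brownian_motion N T V"
  shows "distr M (Pi\<^sub>M {0..T} (\<lambda>_. borel)) (\<lambda>\<omega>. \<lambda>s\<in>{0..T}. W s \<omega>)
       = distr N (Pi\<^sub>M {0..T} (\<lambda>_. borel)) (\<lambda>\<omega>. \<lambda>s\<in>{0..T}. V s \<omega>)"
proof (rule measure_eqI_PiM_infinite)
  interpret M: prob_space M by fact
  show "finite_measure (distr M (Pi\<^sub>M {0..T} (\<lambda>_. borel)) (\<lambda>\<omega>. \<lambda>s\<in>{0..T}. W s \<omega>))"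
    using W by (intro M.finite_measure_distr measurable_restrict) (auto simp: brownian_motion_def)
next
  fix A :: "real \<Rightarrow> (real ^ 'c) set" and J
  assume J: "finite J" "J \<subseteq> {0..T}" and A: "\<And>i. i \<in> J \<Longrightarrow> A i \<in> sets borel"
  have cylinder: "emeasure (distr L (Pi\<^sub>M {0..T} (\<lambda>_. borel)) (\<lambda>\<omega>. \<lambda>s\<in>{0..T}. B s \<omega>))
        (prod_emb {0..T} (\<lambda>_. borel) J (Pi\<^sub>E J A))
      = emeasure (distr L (Pi\<^sub>M J (\<lambda>_. borel)) (\<lambda>\<omega>. \<lambda>s\<in>J. B s \<omega>)) (Pi\<^sub>E J A)"
    if B: "brownian_motion L T B" for L :: "'d measure" and B :: "real \<Rightarrow> 'd \<Rightarrow> real ^ 'c"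
  proof -
    have rv: "B s \<in> borel_measurable L" if "s \<in> {0..T}" for s
      using B that by (auto simp: brownian_motion_def)
    have "(\<lambda>\<omega>. \<lambda>s\<in>{0..T}. B s \<omega>) \<in> L \<rightarrow>\<^sub>M Pi\<^sub>M {0..T} (\<lambda>_. borel)"
      "(\<lambda>\<omega>. \<lambda>s\<in>J. B s \<omega>) \<in> L \<rightarrow>\<^sub>M Pi\<^sub>M J (\<lambda>_. borel)"
      using J(2) by (auto intro!: measurable_restrict rv)
    moreover have "prod_emb {0..T} (\<lambda>_. borel) J (Pi\<^sub>E J A) \<in> sets (Pi\<^sub>M {0..T} (\<lambda>_. borel))"
      "Pi\<^sub>E J A \<in> sets (Pi\<^sub>M J (\<lambda>_. borel))"
      using J A by (auto intro!: sets_PiM_I sets_PiM_I_finite)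
    moreover have "(\<lambda>\<omega>. \<lambda>s\<in>{0..T}. B s \<omega>) -` prod_emb {0..T} (\<lambda>_. borel) J (Pi\<^sub>E J A)
        = (\<lambda>\<omega>. \<lambda>s\<in>J. B s \<omega>) -` Pi\<^sub>E J A"
      by (auto simp: prod_emb_def Int_absorb1[OF J(2)])
    ultimately show ?thesis
      by (simp only: emeasure_distr)
  qed
  show "emeasure (distr M (Pi\<^sub>M {0..T} (\<lambda>_. borel)) (\<lambda>\<omega>. \<lambda>s\<in>{0..T}. W s \<omega>))
        (prod_emb {0..T} (\<lambda>_. borel) J (Pi\<^sub>E J A))
      = emeasure (distr N (Pi\<^sub>M {0..T} (\<lambda>_. borel)) (\<lambda>\<omega>. \<lambda>s\<in>{0..T}. V s \<omega>))
        (prod_emb {0..T} (\<lambda>_. borel) J (Pi\<^sub>E J A))"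
    by (simp only: cylinder[OF W] cylinder[OF V] brownian_finite_marginal_law_eq[OF assms J])
qed simp_all

section \<open>Uniqueness in law of the strong solution\<close>

lemma augmented_filtration_measurable:
  assumes W: "brownian_motion M T W" and "t \<le> T"
    and X: "X \<in> augmented_filtration M W t \<rightarrow>\<^sub>M N"
  shows "X \<in> M \<rightarrow>\<^sub>M N"
proof -
  let ?G = "{W s -` B \<inter> space M | s B. s \<in> {0..t} \<and> B \<in> sets borel} \<union> null_sets M"
  have sub: "?G \<subseteq> sets M"
    using W \<open>t \<le> T\<close> by (auto simp: brownian_motion_def intro!: measurable_sets)
  hence "?G \<subseteq> Pow (space M)"
    using sets.space_closed by blast
  hence "space (augmented_filtration M W t) = space M"
    "sets (augmented_filtration M W t) = sigma_sets (space M) ?G"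
    unfolding augmented_filtration_def by (simp_all only: space_measure_of sets_measure_of)
  moreover have "sigma_sets (space M) ?G \<subseteq> sets M"
    by (rule sets.sigma_sets_subset[OF sub])
  ultimately show ?thesis
    using X by (auto simp: measurable_def)
qed

text \<open>
  Uniqueness in law: both terminal values are almost surely the image under one and the same functional of the
  respective driving paths, whose laws agree.
\<close>

lemma strong_solution_law_eq:
  assumes "prob_space M" "0 \<le> T" and strong: "has_unique_strong_solution M T b \<sigma> x"
    and X: "sde_solution M T b \<sigma> x W X" and Y: "sde_solution M T b \<sigma> x V Y"
  shows "distr M borel (X T) = distr M borel (Y T)"
proof -
  have T: "T \<in> {0..T}"
    using \<open>0 \<le> T\<close> by simp
  obtain F :: "real \<Rightarrow> (real \<Rightarrow> real ^ 'c) \<Rightarrow> real ^ 'b" where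
    "\<forall>t\<in>{0..T}. F t \<in> borel_measurable (Pi\<^sub>M {0..t} (\<lambda>_. borel))"
    and F_all: "\<forall>B. brownian_motion M T B \<longrightarrow> (\<exists>Z. sde_solution M T b \<sigma> x B Z) \<and>
      (\<forall>Z. sde_solution M T b \<sigma> x B Z \<longrightarrow>
        (\<forall>t\<in>{0..T}. AE \<omega> in M. Z t \<omega> = F t (\<lambda>s\<in>{0..t}. B s \<omega>)))"
    using strong unfolding has_unique_strong_solution_def by blast
  hence F: "F T \<in> borel_measurable (Pi\<^sub>M {0..T} (\<lambda>_. borel))"
    using T by blast
  have functional: "AE \<omega> in M. Z T \<omega> = F T (\<lambda>s\<in>{0..T}. B s \<omega>)"
    if Z: "sde_solution M T b \<sigma> x B Z" for B Z
  proof -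
    have "brownian_motion M T B"
      using Z by (simp add: sde_solution_def)
    with F_all Z T show ?thesis by blast
  qed
  have law: "distr M borel (Z T)
      = distr (distr M (Pi\<^sub>M {0..T} (\<lambda>_. borel)) (\<lambda>\<omega>. \<lambda>s\<in>{0..T}. B s \<omega>)) borel (F T)"
    if Z: "sde_solution M T b \<sigma> x B Z" for B Z
  proof -
    have B: "brownian_motion M T B"
      using Z by (simp add: sde_solution_def)
    have path: "(\<lambda>\<omega>. \<lambda>s\<in>{0..T}. B s \<omega>) \<in> M \<rightarrow>\<^sub>M Pi\<^sub>M {0..T} (\<lambda>_. borel)"
      using B by (intro measurable_restrict) (auto simp: brownian_motion_def)
    have "Z T \<in> borel_measurable M"
      using Z \<open>0 \<le> T\<close> by (intro augmented_filtration_measurable[OF B order_refl])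
        (auto simp: sde_solution_def)
    hence "distr M borel (Z T) = distr M borel (\<lambda>\<omega>. F T (\<lambda>s\<in>{0..T}. B s \<omega>))"
      by (intro distr_cong_AE refl functional[OF Z] measurable_compose[OF path F])
    thus ?thesis
      by (simp add: distr_distr[OF F path] comp_def)
  qed
  have "brownian_motion M T W" "brownian_motion M T V"
    using X Y by (simp_all add: sde_solution_def)
  thus ?thesis
    by (simp only: law[OF X] law[OF Y] brownian_path_law_eq[OF assms(1,1,2), of W V])
qed

section \<open>The exact quadrature formula\<close>

text \<open>
  The double sum is the variance of the linear combination.
\<close>

lemma (in prob_space) zero_variance_combination:
  fixes Y :: "'i \<Rightarrow> 'a \<Rightarrow> real"
  assumes "finite I"
    and rv: "\<And>r. r \<in> I \<Longrightarrow> random_variable borel (Y r)"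
    and sq: "\<And>r. r \<in> I \<Longrightarrow> integrable M (\<lambda>\<omega>. (Y r \<omega>)\<^sup>2)"
    and zero: "(\<Sum>r\<in>I. \<Sum>s\<in>I. a r * a s * covariance M (Y r) (Y s)) = 0"
  shows "AE \<omega> in M. (\<Sum>r\<in>I. a r * Y r \<omega>) = (\<Sum>r\<in>I. a r * expectation (Y r))"
proof -
  define D where "D r \<omega> = Y r \<omega> - expectation (Y r)" for r \<omega>
  have D_rv: "random_variable borel (D r)" if "r \<in> I" for r
    using rv[OF that] by (simp add: D_def[abs_def])
  have D_sq: "integrable M (\<lambda>\<omega>. (D r \<omega>)\<^sup>2)" if "r \<in> I" for r
    using sq[OF that] square_integrable_imp_integrable[OF rv[OF that] sq[OF that]]
    by (simp add: D_def power2_diff)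
  \<comment> \<open>Without integrability the covariance would carry no information, since the integral defaults to \<open>0\<close>.\<close>
  have D_prod: "integrable M (\<lambda>\<omega>. D r \<omega> * D s \<omega>)" if "r \<in> I" "s \<in> I" for r s
  proof (rule Bochner_Integration.integrable_bound)
    show "integrable M (\<lambda>\<omega>. (D r \<omega>)\<^sup>2 + (D s \<omega>)\<^sup>2)"
      using that by (intro Bochner_Integration.integrable_add D_sq)
    show "(\<lambda>\<omega>. D r \<omega> * D s \<omega>) \<in> borel_measurable M"
      using that by (intro borel_measurable_times D_rv)
    have "\<bar>u * v\<bar> \<le> u\<^sup>2 + v\<^sup>2" for u v :: real
      using sum_squares_bound[of "\<bar>u\<bar>" "\<bar>v\<bar>"] mult_nonneg_nonneg[of "\<bar>u\<bar>" "\<bar>v\<bar>"]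
      unfolding abs_mult power2_abs by linarith
    thus "AE \<omega> in M. norm (D r \<omega> * D s \<omega>) \<le> norm ((D r \<omega>)\<^sup>2 + (D s \<omega>)\<^sup>2)"
      by simp
  qed
  have expand: "(\<Sum>r\<in>I. a r * D r \<omega>)\<^sup>2 = (\<Sum>r\<in>I. \<Sum>s\<in>I. a r * a s * (D r \<omega> * D s \<omega>))" for \<omega>
    by (simp add: power2_eq_square sum_product mult_ac)
  have "expectation (\<lambda>\<omega>. (\<Sum>r\<in>I. a r * D r \<omega>)\<^sup>2) = 0"
    using zero D_prod unfolding expand
    by (simp add: Bochner_Integration.integral_sum integrable_sum covariance_def D_def)
  moreover have "integrable M (\<lambda>\<omega>. (\<Sum>r\<in>I. a r * D r \<omega>)\<^sup>2)"
    unfolding expand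
    by (intro Bochner_Integration.integrable_sum integrable_mult_right D_prod)
  ultimately have "AE \<omega> in M. (\<Sum>r\<in>I. a r * D r \<omega>)\<^sup>2 = 0"
    by (subst (asm) integral_nonneg_eq_0_iff_AE) auto
  thus ?thesis
    by eventually_elim (simp add: D_def algebra_simps sum_subtractf)
qed

text \<open>
  For the covariance matrix \<open>u u\<^sup>*\<close> with \<open>u = (1, -1, -1)\<close> the variance of the extrapolation is
  \<open>Var (f X\<^sub>T)\<close> times \<open>(1/2 + 4 - 9/2)\<^sup>2 = 0\<close>, so the extrapolation is almost surely equal to its mean. That mean
  is \<open>E f X\<^sub>T\<close> because the weights sum to \<open>1\<close> and the three copies share the law of \<open>X\<^sub>T\<close>. Equality of
  laws also provides the integrability of the squares of the copies.
\<close>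

lemma anticorrelated_extrapolation_exact:
  fixes f :: "real ^ 'd \<Rightarrow> real"
  assumes "prob_space M" "0 \<le> T" and strong: "has_unique_strong_solution M T b \<sigma> x"
    and X: "sde_solution M T b \<sigma> x W X"
    and Xr: "\<And>r. r \<in> {1..3} \<Longrightarrow> sde_solution M T b \<sigma> x (Wr r) (Xr r)"
    and f: "f \<in> borel_measurable borel"
    and sq: "integrable M (\<lambda>\<omega>. (f (X T \<omega>))\<^sup>2)"
    and var: "0 < prob_space.variance M (\<lambda>\<omega>. f (X T \<omega>))"
    and cov: "\<And>r s. r \<in> {1..3} \<Longrightarrow> s \<in> {1..3} \<Longrightarrow>
         normalized_cov M (\<lambda>\<omega>. f (X T \<omega>)) (\<lambda>r \<omega>. f (Xr r T \<omega>)) r s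
           = outer (\<lambda>i. if i = 1 then 1 else - 1) r s"
  shows "AE \<omega> in M. (\<Sum>r=1..3. rr_weight 3 r * f (Xr r T \<omega>)) = prob_space.expectation M (\<lambda>\<omega>. f (X T \<omega>))"
proof -
  interpret prob_space M by fact
  let ?u = "\<lambda>i::nat. if i = 1 then 1 else - 1 :: real"
  have rv: "Z T \<in> borel_measurable M" if "sde_solution M T b \<sigma> x B Z" for B Z
    using that \<open>0 \<le> T\<close> by (intro augmented_filtration_measurable[of M T B T])
        (auto simp: sde_solution_def)
  note law = strong_solution_law_eq[OF assms(1,2) strong X Xr]
  have f2: "(\<lambda>y. (f y)\<^sup>2) \<in> borel_measurable borel"
    using f by measurable
  have mean: "expectation (\<lambda>\<omega>. f (Xr r T \<omega>)) = expectation (\<lambda>\<omega>. f (X T \<omega>))" if "r \<in> {1..3}" for r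
    using integral_distr[OF rv[OF X] f] integral_distr[OF rv[OF Xr] f] that by (simp add: law)
  have sqr: "integrable M (\<lambda>\<omega>. (f (Xr r T \<omega>))\<^sup>2)" if "r \<in> {1..3}" for r
    using integrable_distr_eq[OF rv[OF X] f2] integrable_distr_eq[OF rv[OF Xr] f2] that sq
    by (simp add: law)
  have covar: "covariance M (\<lambda>\<omega>. f (Xr r T \<omega>)) (\<lambda>\<omega>. f (Xr s T \<omega>))
      = variance (\<lambda>\<omega>. f (X T \<omega>)) * outer ?u r s" if "r \<in> {1..3}" "s \<in> {1..3}" for r s
    using cov[OF that] var by (simp add: normalized_cov_def field_simps)
  have "AE \<omega> in M. (\<Sum>r=1..3. rr_weight 3 r * f (Xr r T \<omega>))
      = (\<Sum>r=1..3. rr_weight 3 r * expectation (\<lambda>\<omega>. f (Xr r T \<omega>)))"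
  proof (rule zero_variance_combination)
    have "(\<Sum>r=1..3. \<Sum>s=1..3. rr_weight 3 r * rr_weight 3 s
          * covariance M (\<lambda>\<omega>. f (Xr r T \<omega>)) (\<lambda>\<omega>. f (Xr s T \<omega>)))
        = variance (\<lambda>\<omega>. f (X T \<omega>)) * (\<Sum>r=1..3. rr_weight 3 r * ?u r)\<^sup>2"
      by (simp add: covar outer_def power2_eq_square sum_product sum_distrib_left mult_ac)
    also have "(\<Sum>r=1..3. rr_weight 3 r * ?u r) = 0"
      by (simp add: eval_nat_numeral rr_weight_def)
    finally show "(\<Sum>r=1..3. \<Sum>s=1..3. rr_weight 3 r * rr_weight 3 s
          * covariance M (\<lambda>\<omega>. f (Xr r T \<omega>)) (\<lambda>\<omega>. f (Xr s T \<omega>))) = 0"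
      by simp
  qed (auto intro: sqr measurable_compose[OF rv[OF Xr] f])
  also have "(\<Sum>r=1..3. rr_weight 3 r * expectation (\<lambda>\<omega>. f (Xr r T \<omega>))) = expectation (\<lambda>\<omega>. f (X T \<omega>))"
    by (simp add: mean eval_nat_numeral rr_weight_def)
  finally show ?thesis .
qed

theorem mainTheorem5:
  fixes M :: "'a measure" and T :: real
    and b :: "real \<Rightarrow> real ^ 'd \<Rightarrow> real ^ 'd"
    and \<sigma> :: "real \<Rightarrow> real ^ 'd \<Rightarrow> real ^ 'q ^ 'd"
    and x :: "real ^ 'd" and f :: "real ^ 'd \<Rightarrow> real"
    and W :: "real \<Rightarrow> 'a \<Rightarrow> real ^ 'q" and X :: "real \<Rightarrow> 'a \<Rightarrow> real ^ 'd"
    and Wr :: "nat \<Rightarrow> real \<Rightarrow> 'a \<Rightarrow> real ^ 'q" and Xr :: "nat \<Rightarrow> real \<Rightarrow> 'a \<Rightarrow> real ^ 'd"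
    and \<epsilon> :: "'a \<Rightarrow> real"
  shows
    "(\<forall>R\<ge>3.
        (\<exists>S. is_arg_min (\<lambda>S. quad_form R S (rr_weight R)) (admissible R) S \<and>
             quad_form R S (rr_weight R) = 0) \<and>
        \<not> is_arg_min (\<lambda>S. quad_form R S (rr_weight R)) (admissible R) (outer (\<lambda>_. 1)))
     \<and>
     (prob_space M \<and> 0 < T \<and>
      has_unique_strong_solution M T b \<sigma> x \<and>
      sde_solution M T b \<sigma> x W X \<and>
      (\<forall>r\<in>{1..3}. sde_solution M T b \<sigma> x (Wr r) (Xr r)) \<and>
      f \<in> borel_measurable borel \<and>
      integrable M (\<lambda>\<omega>. f (X T \<omega>)) \<and>
      integrable M (\<lambda>\<omega>. (f (X T \<omega>))\<^sup>2) \<and>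
      0 < prob_space.variance M (\<lambda>\<omega>. f (X T \<omega>)) \<and>
      weak_error_expansion M T b \<sigma> x W X 3 f \<and>
      \<epsilon> \<in> borel_measurable M \<and>
      measure M {\<omega>\<in>space M. \<epsilon> \<omega> = 1} = 1 / 2 \<and>
      measure M {\<omega>\<in>space M. \<epsilon> \<omega> = - 1} = 1 / 2 \<and>
      (AE \<omega> in M. f (X T \<omega>) = prob_space.expectation M (\<lambda>\<omega>. f (X T \<omega>))
                     + sqrt (prob_space.variance M (\<lambda>\<omega>. f (X T \<omega>))) * \<epsilon> \<omega>) \<and>
      (\<forall>r\<in>{1..3}. \<forall>s\<in>{1..3}.
         normalized_cov M (\<lambda>\<omega>. f (X T \<omega>)) (\<lambda>r \<omega>. f (Xr r T \<omega>)) r s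
           = outer (\<lambda>i. if i = 1 then 1 else - 1) r s)
      \<longrightarrow>
      (AE \<omega> in M. (\<Sum>r=1..3. rr_weight 3 r * f (Xr r T \<omega>))
                     = prob_space.expectation M (\<lambda>\<omega>. f (X T \<omega>))))"
proof (intro conjI allI impI)
  fix R :: nat
  assume "3 \<le> R"
  thus "\<exists>S. is_arg_min (\<lambda>S. quad_form R S (rr_weight R)) (admissible R) S \<and>
             quad_form R S (rr_weight R) = 0"
    and "\<not> is_arg_min (\<lambda>S. quad_form R S (rr_weight R)) (admissible R) (outer (\<lambda>_. 1))"
    by (rule rr_weight_minimum_zero)+
qed (rule anticorrelated_extrapolation_exact[where b = b and \<sigma> = \<sigma> and x = x and W = W and Wr = Wr],
  auto)

end
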